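(* On a basis $\{e_1,e_2\}$ of $\mathbb{R}^2$ let $\psi_0,\dots,\psi_5$ be the Jordan algebras with commutative products $\psi_0$: $e_1\circ e_1=e_1$, $e_2\circ e_2=e_1$, $e_1\circ e_2=e_2$; $\psi_1$: $e_1\circ e_1=e_1$, $e_2\circ e_2=0$, $e_1\circ e_2=e_2$; $\psi_2$: $e_1\circ e_1=0$, $e_2\circ e_2=e_2$, $e_1\circ e_2=0$; $\psi_3$: $e_1\circ e_1=e_2$, $e_2\circ e_2=0$, $e_1\circ e_2=0$; $\psi_4$: $e_1\circ e_1=e_1$, $e_2\circ e_2=0$, $e_1\circ e_2=\frac12 e_2$; $\psi_5$: $e_1\circ e_1=e_1$, $e_2\circ e_2=-e_1$, $e_1\circ e_2=e_2$. Then, up to isomorphism, $\psi_1$, $\psi_2$ and $\psi_3$ are the only nonzero Jordan algebras in $J^2$ that appear as a non-trivial contraction of a Jordan algebra in $J^2$. More precisely: 1. $\psi_1$ is a contraction of the algebras $\psi_0$ and $\psi_5$; 2. $\psi_2$ is a contraction of $\psi_0$; 3. $\psi_3$ is a contraction of $\psi_0$, $\psi_1$, $\psi_2$ and $\psi_5$.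
   Context: $J^n$ is the set of Jordan algebra laws on $\mathbb{R}^n$, i.e. symmetric bilinear maps $\varphi:\mathbb{R}^n\times\mathbb{R}^n\to\mathbb{R}^n$ with $\varphi(\varphi(X,X),\varphi(X,Y))=\varphi(X,\varphi(\varphi(X,X),Y))$ for all $X,Y$. Two laws $\varphi,\varphi'$ are isomorphic if $\varphi'=f^{-1}\circ\varphi\circ(f,f)$ for some $f\in GL(n,\mathbb{R})$. Given $\varphi\in J^n$ and a family $f_t\in GL(n,\mathbb{R})$ depending on a continuous parameter $t>0$, if the limit $\varphi'(X,Y)=\lim_{t\to0}f_t^{-1}(\varphi(f_t(X),f_t(Y)))$ exists for all $X,Y\in\mathbb{R}^n$, then $\varphi'\in J^n$ is called the contraction of $\varphi$ by $\{f_t\}$. An algebra is called a contraction of $\varphi$ if it is isomorphic to such a $\varphi'$. The contraction is non-trivial if $\varphi'$ is not isomorphic to $\varphi$. *)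

theory Defs
  imports "HOL-Analysis.Analysis"
begin

definition commutative_law :: "(real^'n \<Rightarrow> real^'n \<Rightarrow> real^'n) \<Rightarrow> bool" where
  "commutative_law \<phi> \<longleftrightarrow> bilinear \<phi> \<and> (\<forall>X Y. \<phi> X Y = \<phi> Y X)"

definition jordan_laws :: "(real^'n \<Rightarrow> real^'n \<Rightarrow> real^'n) set" where
  "jordan_laws = {\<phi>. commutative_law \<phi> \<and>
     (\<forall>X Y. \<phi> (\<phi> X X) (\<phi> X Y) = \<phi> X (\<phi> (\<phi> X X) Y))}"

definition GL :: "(real^'n \<Rightarrow> real^'n) set" where
  "GL = {f. linear f \<and> bij f}"

definition isomorphic_laws ::
    "(real^'n \<Rightarrow> real^'n \<Rightarrow> real^'n) \<Rightarrow> (real^'n \<Rightarrow> real^'n \<Rightarrow> real^'n) \<Rightarrow> bool" where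
  "isomorphic_laws \<phi> \<phi>' \<longleftrightarrow> (\<exists>f\<in>GL. \<forall>X Y. \<phi>' X Y = inv f (\<phi> (f X) (f Y)))"

text \<open>The parameter \<open>t\<close> ranges over the positive reals and tends to 0 from the right. No continuity
  of \<open>t \<mapsto> f t\<close> is imposed.\<close>

definition contraction_by ::
    "(real^'n \<Rightarrow> real^'n \<Rightarrow> real^'n) \<Rightarrow> (real \<Rightarrow> real^'n \<Rightarrow> real^'n) \<Rightarrow>
     (real^'n \<Rightarrow> real^'n \<Rightarrow> real^'n) \<Rightarrow> bool" where
  "contraction_by \<phi> f \<phi>' \<longleftrightarrow> \<phi> \<in> jordan_laws \<and> (\<forall>t>0. f t \<in> GL) \<and>
     (\<forall>X Y. ((\<lambda>t. inv (f t) (\<phi> (f t X) (f t Y))) \<longlongrightarrow> \<phi>' X Y) (at_right 0))"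

text \<open>\<open>is_contraction_of \<phi>' \<phi>\<close>: the algebra \<open>\<phi>'\<close> is a contraction of \<open>\<phi>\<close>.\<close>

definition is_contraction_of ::
    "(real^'n \<Rightarrow> real^'n \<Rightarrow> real^'n) \<Rightarrow> (real^'n \<Rightarrow> real^'n \<Rightarrow> real^'n) \<Rightarrow> bool" where
  "is_contraction_of \<phi>' \<phi> \<longleftrightarrow> (\<exists>f \<phi>''. contraction_by \<phi> f \<phi>'' \<and> isomorphic_laws \<phi>' \<phi>'')"

definition is_nontrivial_contraction_of ::
    "(real^'n \<Rightarrow> real^'n \<Rightarrow> real^'n) \<Rightarrow> (real^'n \<Rightarrow> real^'n \<Rightarrow> real^'n) \<Rightarrow> bool" where
  "is_nontrivial_contraction_of \<phi>' \<phi> \<longleftrightarrow>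
     is_contraction_of \<phi>' \<phi> \<and> \<not> isomorphic_laws \<phi>' \<phi>"

end

(* A nonzero planar Jordan algebra either has an idempotent, and the Peirce decomposition gives one
   of psi_0, psi_1, psi_2, psi_4, psi_5, or it has none, and then it is spanned by x and x^2 with
   x^3 = 0, which is psi_3.  Contractions preserve every closed isomorphism invariant condition.
   The Gram determinant of the trace form (X, Y) |-> tr L_{XY} is positive for some X, Y only on the
   orbit of psi_0 and negative only on the orbit of psi_5, and associativity fails only on the
   orbit of psi_4; hence these three orbits are open and the algebras are no non-trivial
   contractions.  The contractions onto psi_1, psi_2 and psi_3 come from the bases (e_1, t e_2),
   (t f, g) with orthogonal idempotents f, g, and (t x, t^2 x^2). *)

theory Submission
  imports Defs
begin

section \<open>The determinant \<open>area\<close> and frames of the plane\<close>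

definition area :: "real^2 \<Rightarrow> real^2 \<Rightarrow> real" where
  "area u v = u$1 * v$2 - u$2 * v$1"

text \<open>The linear map taking the standard basis to \<open>u\<close>, \<open>v\<close>, so that
  families in \<open>GL\<close> can be prescribed by moving bases.\<close>

definition frame :: "real^2 \<Rightarrow> real^2 \<Rightarrow> real^2 \<Rightarrow> real^2" where
  "frame u v X = X$1 *\<^sub>R u + X$2 *\<^sub>R v"

text \<open>The pairs \<open>(a, b)\<close>, \<open>(c, d)\<close>, \<open>(p, q)\<close> are the coordinates of the products
  \<open>e\<^sub>1 e\<^sub>1\<close>, \<open>e\<^sub>1 e\<^sub>2\<close>, \<open>e\<^sub>2 e\<^sub>2\<close> of the basis vectors.\<close>

definition law :: "real \<Rightarrow> real \<Rightarrow> real \<Rightarrow> real \<Rightarrow> real \<Rightarrow> real \<Rightarrow> real^2 \<Rightarrow> real^2 \<Rightarrow> real^2" where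
  "law a b c d p q X Y =
     vector [a * (X$1 * Y$1) + c * (X$1 * Y$2 + X$2 * Y$1) + p * (X$2 * Y$2),
             b * (X$1 * Y$1) + d * (X$1 * Y$2 + X$2 * Y$1) + q * (X$2 * Y$2)]"

definition has_table where
  "has_table \<phi> u v a b c d p q \<longleftrightarrow> commutative_law \<phi> \<and> area u v \<noteq> 0 \<and>
     \<phi> u u = a *\<^sub>R u + b *\<^sub>R v \<and> \<phi> u v = c *\<^sub>R u + d *\<^sub>R v \<and> \<phi> v v = p *\<^sub>R u + q *\<^sub>R v"

lemma real2_eq_iff: "(X::real^2) = Y \<longleftrightarrow> X$1 = Y$1 \<and> X$2 = Y$2"
  by (simp add: vec_eq_iff forall_2)

text \<open>Cramer's rule.\<close>

lemma area_expand:
  assumes "area u v \<noteq> 0"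
  shows "X = (area X v / area u v) *\<^sub>R u + (area u X / area u v) *\<^sub>R v"
proof -
  have "area u v * X$1 = area X v * u$1 + area u X * v$1"
    "area u v * X$2 = area X v * u$2 + area u X * v$2"
    by (simp_all add: area_def algebra_simps)
  then show ?thesis
    using assms by (simp add: real2_eq_iff field_simps)
qed

lemma frame_inj:
  assumes "area u v \<noteq> 0" "frame u v X = frame u v Y"
  shows "X = Y"
proof -
  \<comment> \<open>Pairing with \<open>v\<close> and with \<open>u\<close> recovers each coordinate
    up to the factor \<open>area u v\<close>.\<close>
  have "area (frame u v Z) v = Z$1 * area u v" "area u (frame u v Z) = Z$2 * area u v" for Z
    by (simp_all add: area_def frame_def algebra_simps)
  with assms show ?thesis
    by (metis mult_right_cancel real2_eq_iff)
qed

lemma frame_GL: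
  assumes "area u v \<noteq> 0"
  shows "frame u v \<in> GL"
proof -
  have "linear (frame u v)"
    by (rule linearI) (simp_all add: frame_def algebra_simps)
  moreover have "inj (frame u v)"
    using frame_inj[OF assms] by (auto intro: injI)
  ultimately show ?thesis
    by (simp add: GL_def bij_def linear_injective_imp_surjective)
qed

lemma area_scaleR [simp]:
  "area (a *\<^sub>R u) v = a * area u v" "area u (a *\<^sub>R v) = a * area u v"
  by (simp_all add: area_def algebra_simps)

lemma area_add [simp]:
  "area (u + u') v = area u v + area u' v" "area u (v + v') = area u v + area u v'"
  by (simp_all add: area_def algebra_simps)

lemma area_diff [simp]:
  "area (u - u') v = area u v - area u' v" "area u (v - v') = area u v - area u v'"
  by (simp_all add: area_def algebra_simps)

lemma area_minus [simp]: "area (- u) v = - area u v" "area u (- v) = - area u v"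
  by (simp_all add: area_def)

lemma area_self [simp]: "area u u = 0"
  by (simp add: area_def)

lemma area_swap: "area v u = - area u v"
  by (simp add: area_def)

text \<open>If the area of \<open>u\<close>, \<open>v\<close> vanished, it would vanish on all pairs
  from their span, in particular on the standard basis, where it is 1.\<close>

lemma area_nonzero_of_span:
  assumes "span {u, v :: real^2} = UNIV"
  shows "area u v \<noteq> 0"
proof
  assume 0: "area u v = 0"
  have "\<exists>a b. X = a *\<^sub>R u + b *\<^sub>R v" for X
  proof -
    have "X \<in> span {u, v}"
      using assms by simp
    then obtain a b where "X - a *\<^sub>R u = b *\<^sub>R v"
      by (auto simp: span_insert[of u] span_singleton)
    then have "X = a *\<^sub>R u + b *\<^sub>R v"
      by (simp add: algebra_simps)
    then show ?thesis
      by blast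
  qed
  then obtain a b c d where "axis 1 1 = a *\<^sub>R u + b *\<^sub>R v" "axis 2 1 = c *\<^sub>R u + d *\<^sub>R v"
    by metis
  then have "area (axis 1 1) (axis 2 1) = 0"
    using 0 by (simp add: area_swap[of v u])
  then show False
    by (simp add: area_def axis_def)
qed

section \<open>Commutative laws, structure constants and isomorphism\<close>

lemma comm_bilinear:
  assumes "commutative_law \<phi>"
  shows "\<phi> (x + y) z = \<phi> x z + \<phi> y z" "\<phi> z (x + y) = \<phi> z x + \<phi> z y"
    "\<phi> (r *\<^sub>R x) z = r *\<^sub>R \<phi> x z" "\<phi> z (r *\<^sub>R x) = r *\<^sub>R \<phi> z x"
    "\<phi> (x - y) z = \<phi> x z - \<phi> y z" "\<phi> z (x - y) = \<phi> z x - \<phi> z y"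
    "\<phi> (- x) z = - \<phi> x z" "\<phi> z (- x) = - \<phi> z x"
  using assms unfolding commutative_law_def
  by (simp_all add: bilinear_ladd bilinear_radd bilinear_lmul bilinear_rmul
      bilinear_lsub bilinear_rsub bilinear_lneg bilinear_rneg)

lemma comm_commute: "commutative_law \<phi> \<Longrightarrow> \<phi> x y = \<phi> y x"
  unfolding commutative_law_def by blast

lemma law_nth [simp]:
  "law a b c d p q X Y $ 1 = a * (X$1 * Y$1) + c * (X$1 * Y$2 + X$2 * Y$1) + p * (X$2 * Y$2)"
  "law a b c d p q X Y $ 2 = b * (X$1 * Y$1) + d * (X$1 * Y$2 + X$2 * Y$1) + q * (X$2 * Y$2)"
  by (simp_all add: law_def)

text \<open>Pulling a law back along a frame amounts to reading its structure constants in that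
  basis. Thus a multiplication table yields an isomorphism, and a family of tables yields a
  contraction.\<close>

lemma frame_law:
  assumes "has_table \<phi> u v a b c d p q"
  shows "inv (frame u v) (\<phi> (frame u v X) (frame u v Y)) = law a b c d p q X Y"
proof -
  have comm: "commutative_law \<phi>" and nz: "area u v \<noteq> 0"
    using assms by (auto simp: has_table_def)
  have vu: "\<phi> v u = \<phi> u v"
    by (rule comm_commute[OF comm])
  have "\<phi> (frame u v X) (frame u v Y) = frame u v (law a b c d p q X Y)"
    using assms unfolding frame_def has_table_def
    by (simp add: comm_bilinear[OF comm] vu algebra_simps)
  moreover have "inj (frame u v)"
    using frame_GL[OF nz] by (simp add: GL_def bij_def)
  ultimately show ?thesis
    by simp
qed

lemma isomorphic_law:
  assumes "has_table \<phi> u v a b c d p q"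
  shows "isomorphic_laws \<phi> (law a b c d p q)"
  unfolding isomorphic_laws_def
  using frame_law[OF assms] frame_GL assms by (metis has_table_def)

lemma isomorphic_laws_sym:
  assumes "isomorphic_laws \<phi> \<phi>'"
  shows "isomorphic_laws \<phi>' \<phi>"
proof -
  obtain f where f: "f \<in> GL" and eq: "\<And>X Y. \<phi>' X Y = inv f (\<phi> (f X) (f Y))"
    using assms unfolding isomorphic_laws_def by auto
  have fl: "linear f" and fb: "bij f"
    using f by (auto simp: GL_def)
  have "linear (inv f)"
    using fl fb by (simp add: bij_def inj_linear_imp_inv_linear)
  moreover have "\<phi> X Y = inv (inv f) (\<phi>' (inv f X) (inv f Y))" for X Y
    using fb by (simp add: eq inv_inv_eq bij_is_surj surj_f_inv_f)
  ultimately show ?thesis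
    unfolding isomorphic_laws_def using fb by (auto simp: GL_def bij_imp_bij_inv)
qed

lemma isomorphic_laws_trans:
  assumes "isomorphic_laws \<phi> \<phi>'" "isomorphic_laws \<phi>' \<phi>''"
  shows "isomorphic_laws \<phi> \<phi>''"
proof -
  obtain f g where f: "f \<in> GL" "\<And>X Y. \<phi>' X Y = inv f (\<phi> (f X) (f Y))"
    and g: "g \<in> GL" "\<And>X Y. \<phi>'' X Y = inv g (\<phi>' (g X) (g Y))"
    using assms unfolding isomorphic_laws_def by auto
  have "f \<circ> g \<in> GL"
    using f(1) g(1) by (auto simp: GL_def linear_compose bij_comp)
  moreover have "inv (f \<circ> g) = inv g \<circ> inv f"
    using f(1) g(1) by (simp add: GL_def o_inv_distrib)
  ultimately show ?thesis
    unfolding isomorphic_laws_def by (intro bexI[of _ "f \<circ> g"]) (auto simp: f(2) g(2))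
qed

lemma isomorphic_commutative_law:
  assumes "isomorphic_laws \<phi> \<phi>'" "commutative_law \<phi>"
  shows "commutative_law \<phi>'"
proof -
  obtain f where f: "f \<in> GL" and eq: "\<And>X Y. \<phi>' X Y = inv f (\<phi> (f X) (f Y))"
    using assms unfolding isomorphic_laws_def by auto
  have fl: "linear f" and il: "linear (inv f)"
    using f by (auto simp: GL_def bij_def inj_linear_imp_inv_linear)
  have "bilinear \<phi>'"
    unfolding bilinear_def
    by (intro allI conjI linearI)
      (simp_all add: eq comm_bilinear[OF assms(2)] linear_add[OF fl] linear_add[OF il]
        linear_cmul[OF fl] linear_cmul[OF il])
  then show ?thesis
    unfolding commutative_law_def using comm_commute[OF assms(2)] by (simp add: eq)
qed

lemma isomorphic_jordan:
  assumes "isomorphic_laws \<phi> \<phi>'" "\<phi> \<in> jordan_laws"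
  shows "\<phi>' \<in> jordan_laws"
proof -
  obtain f where f: "bij f" and eq: "\<And>X Y. \<phi>' X Y = inv f (\<phi> (f X) (f Y))"
    using assms unfolding isomorphic_laws_def GL_def by auto
  have [simp]: "f (inv f x) = x" for x
    using f by (simp add: bij_is_surj surj_f_inv_f)
  show ?thesis
    using assms(2) isomorphic_commutative_law[OF assms(1)] unfolding jordan_laws_def
    by (simp add: eq)
qed

lemma commutative_law_law: "commutative_law (law a b c d p q)"
  unfolding commutative_law_def bilinear_def
  by (auto intro!: linearI simp: real2_eq_iff algebra_simps)

lemma isomorphic_laws_common:
  assumes "isomorphic_laws \<phi> \<phi>'" "isomorphic_laws \<psi> \<phi>'"
  shows "isomorphic_laws \<phi> \<psi>"
  using assms isomorphic_laws_sym isomorphic_laws_trans by blast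

subsection \<open>Invariants\<close>

definition tr2 :: "(real^2 \<Rightarrow> real^2) \<Rightarrow> real" where
  "tr2 A = A (axis 1 1) $ 1 + A (axis 2 1) $ 2"

text \<open>\<open>\<phi> (\<phi> X Y)\<close>, partially applied, is the operator of multiplication
  by the product of \<open>X\<close> and \<open>Y\<close>.\<close>

definition trace_form :: "(real^2 \<Rightarrow> real^2 \<Rightarrow> real^2) \<Rightarrow> real^2 \<Rightarrow> real^2 \<Rightarrow> real" where
  "trace_form \<phi> X Y = tr2 (\<phi> (\<phi> X Y))"

text \<open>Kept as a function of two vectors: isomorphisms permute these pairs, so the set of
  values is invariant without a choice of basis.\<close>

definition gram :: "(real^2 \<Rightarrow> real^2 \<Rightarrow> real^2) \<Rightarrow> real^2 \<Rightarrow> real^2 \<Rightarrow> real" where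
  "gram \<phi> X Y = trace_form \<phi> X X * trace_form \<phi> Y Y - (trace_form \<phi> X Y)\<^sup>2"

definition associative_law :: "(real^2 \<Rightarrow> real^2 \<Rightarrow> real^2) \<Rightarrow> bool" where
  "associative_law \<phi> \<longleftrightarrow> (\<forall>X Y Z. \<phi> (\<phi> X Y) Z = \<phi> X (\<phi> Y Z))"

lemma linear_axes:
  fixes f :: "real^2 \<Rightarrow> 'b::real_vector"
  assumes "linear f"
  shows "f x = x$1 *\<^sub>R f (axis 1 1) + x$2 *\<^sub>R f (axis 2 1)"
proof -
  have "x = x$1 *\<^sub>R axis 1 1 + x$2 *\<^sub>R axis 2 1"
    by (simp add: real2_eq_iff axis_def)
  then show ?thesis
    using linear_add[OF assms] linear_cmul[OF assms] by metis
qed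

text \<open>The trace as the infinitesimal change of area, a description that does not refer to a
  basis.\<close>

lemma area_trace:
  assumes "linear A"
  shows "area (A u) v + area u (A v) = tr2 A * area u v"
proof -
  show ?thesis
    unfolding linear_axes[OF assms, of u] linear_axes[OF assms, of v] by (simp add: area_def tr2_def algebra_simps)
qed

text \<open>The factor on the right is the determinant of \<open>f\<close>.\<close>

lemma area_linear:
  assumes "linear f"
  shows "area (f u) (f v) = area (f (axis 1 1)) (f (axis 2 1)) * area u v"
proof -
  show ?thesis
    unfolding linear_axes[OF assms, of u] linear_axes[OF assms, of v] by (simp add: area_def algebra_simps)
qed

text \<open>Apply the area description of the trace to \<open>A\<close> on the image of the standard
  basis under \<open>f\<close>; the determinant of \<open>f\<close> appears on both sides and
  cancels.\<close>

lemma tr2_conj: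
  assumes "linear A" "f \<in> GL"
  shows "tr2 (\<lambda>X. inv f (A (f X))) = tr2 A"
proof -
  have fl: "linear f" and fb: "bij f"
    using assms(2) by (auto simp: GL_def)
  have il: "linear (inv f)"
    using fl fb by (auto simp: bij_def inj_linear_imp_inv_linear)
  have [simp]: "f (inv f x) = x" for x
    using fb by (simp add: bij_is_surj surj_f_inv_f)
  define B where "B = (\<lambda>X. inv f (A (f X)))"
  have Bl: "linear B"
    unfolding B_def using assms(1) fl il
    by (auto intro!: linearI simp: linear_add linear_cmul)
  let ?e = "axis 1 1 :: real^2" and ?e' = "axis 2 1 :: real^2"
  let ?D = "area (f ?e) (f ?e')"
  have e1: "area ?e ?e' = 1"
    by (simp add: area_def axis_def)
  have fB: "f (B X) = A (f X)" for X
    by (simp add: B_def)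
  \<comment> \<open>The left side is 1, so the determinant \<open>?D\<close> of \<open>f\<close> is
    a factor of 1.\<close>
  have "area (inv f (f ?e)) (inv f (f ?e')) = area (inv f ?e) (inv f ?e') * ?D"
    using area_linear[OF il] .
  then have nz: "?D \<noteq> 0"
    using fb e1 by (auto simp: bij_is_inj)
  have "tr2 A * ?D = area (f (B ?e)) (f ?e') + area (f ?e) (f (B ?e'))"
    by (simp add: fB area_trace[OF assms(1)])
  also have "\<dots> = ?D * (area (B ?e) ?e' + area ?e (B ?e'))"
    by (subst (1 2) area_linear[OF fl]) (simp add: algebra_simps)
  also have "\<dots> = ?D * tr2 B"
    by (simp add: area_trace[OF Bl] e1)
  finally show ?thesis
    using nz by (simp add: B_def)
qed

text \<open>The multiplication operators of \<open>\<phi>'\<close> are conjugate under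
  \<open>f\<close> to those of \<open>\<phi>\<close>, and conjugation preserves the trace.\<close>

lemma trace_form_transport:
  assumes "f \<in> GL" "commutative_law \<phi>" "\<And>X Y. \<phi>' X Y = inv f (\<phi> (f X) (f Y))"
  shows "trace_form \<phi>' X Y = trace_form \<phi> (f X) (f Y)"
proof -
  have [simp]: "f (inv f x) = x" for x
    using assms(1) by (simp add: GL_def bij_is_surj surj_f_inv_f)
  have "\<phi>' (\<phi>' X Y) = (\<lambda>Z. inv f (\<phi> (\<phi> (f X) (f Y)) (f Z)))"
    by (rule ext) (simp add: assms(3))
  moreover have "linear (\<phi> (\<phi> (f X) (f Y)))"
    by (rule linearI) (simp_all add: comm_bilinear[OF assms(2)])
  ultimately show ?thesis
    by (simp add: trace_form_def tr2_conj[OF _ assms(1)])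
qed

lemma gram_transport:
  assumes "f \<in> GL" "commutative_law \<phi>" "\<And>X Y. \<phi>' X Y = inv f (\<phi> (f X) (f Y))"
  shows "gram \<phi>' X Y = gram \<phi> (f X) (f Y)"
  by (simp add: gram_def trace_form_transport[OF assms])

lemma associative_transport:
  assumes "f \<in> GL" "associative_law \<phi>" "\<And>X Y. \<phi>' X Y = inv f (\<phi> (f X) (f Y))"
  shows "associative_law \<phi>'"
proof -
  have [simp]: "f (inv f x) = x" for x
    using assms(1) by (simp add: GL_def bij_is_surj surj_f_inv_f)
  show ?thesis
    using assms(2) by (simp add: associative_law_def assms(3))
qed

text \<open>The predicate \<open>P\<close> is left open so as to cover both signs, non-vanishing and
  membership in an open set.\<close>

lemma isomorphic_gram:
  assumes "isomorphic_laws \<phi> \<phi>'" "commutative_law \<phi>" "P (gram \<phi>' X Y)"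
  shows "\<exists>X Y. P (gram \<phi> X Y)"
  using assms gram_transport unfolding isomorphic_laws_def by metis

lemma isomorphic_trace_form:
  assumes "isomorphic_laws \<phi> \<phi>'" "commutative_law \<phi>" "P (trace_form \<phi>' X Y)"
  shows "\<exists>X Y. P (trace_form \<phi> X Y)"
  using assms trace_form_transport unfolding isomorphic_laws_def by metis

lemma isomorphic_associative:
  assumes "isomorphic_laws \<phi> \<phi>'"
  shows "associative_law \<phi> \<longleftrightarrow> associative_law \<phi>'"
  using assms isomorphic_laws_sym[OF assms] associative_transport
  unfolding isomorphic_laws_def by metis

text \<open>\<open>a + d\<close> and \<open>c + q\<close> are the traces of multiplication by the
  first and second basis vector.\<close>

lemma trace_form_law:
  "trace_form (law a b c d p q) X Y =
     (a + d) * law a b c d p q X Y $ 1 + (c + q) * law a b c d p q X Y $ 2"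
  by (simp add: trace_form_def tr2_def axis_def algebra_simps)

section \<open>Passing to the limit along a contraction\<close>

text \<open>Pointwise convergence of laws allows a convergent first argument: expand it in the
  standard basis, so that only two fixed products and two convergent coefficients remain.\<close>

lemma tendsto_commutative_law:
  fixes \<Phi> :: "real \<Rightarrow> real^2 \<Rightarrow> real^2 \<Rightarrow> real^2"
  assumes comm: "\<forall>\<^sub>F t in F. commutative_law (\<Phi> t)"
    and lim: "\<And>X Y. ((\<lambda>t. \<Phi> t X Y) \<longlongrightarrow> \<phi> X Y) F"
    and x: "(x \<longlongrightarrow> X) F" and com: "commutative_law \<phi>"
  shows "((\<lambda>t. \<Phi> t (x t) Y) \<longlongrightarrow> \<phi> X Y) F"
proof -
  let ?e = "axis 1 1 :: real^2" and ?e' = "axis 2 1 :: real^2"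
  have ex: "z = z$1 *\<^sub>R ?e + z$2 *\<^sub>R ?e'" for z :: "real^2"
    by (simp add: real2_eq_iff axis_def)
  have split: "\<psi> z Y = z$1 *\<^sub>R \<psi> ?e Y + z$2 *\<^sub>R \<psi> ?e' Y" if "commutative_law \<psi>" for \<psi> z
    using ex[of z] comm_bilinear[OF that] by metis
  have "((\<lambda>t. x t $ 1 *\<^sub>R \<Phi> t ?e Y + x t $ 2 *\<^sub>R \<Phi> t ?e' Y) \<longlongrightarrow>
      X$1 *\<^sub>R \<phi> ?e Y + X$2 *\<^sub>R \<phi> ?e' Y) F"
    by (intro tendsto_intros lim x)
  then have "((\<lambda>t. x t $ 1 *\<^sub>R \<Phi> t ?e Y + x t $ 2 *\<^sub>R \<Phi> t ?e' Y) \<longlongrightarrow> \<phi> X Y) F"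
    using split[OF com, of X] by simp
  moreover have "\<forall>\<^sub>F t in F. x t $ 1 *\<^sub>R \<Phi> t ?e Y + x t $ 2 *\<^sub>R \<Phi> t ?e' Y = \<Phi> t (x t) Y"
    using comm by eventually_elim (metis split)
  ultimately show ?thesis
    by (rule Lim_transform_eventually)
qed

definition pullback ::
    "(real^2 \<Rightarrow> real^2) \<Rightarrow> (real^2 \<Rightarrow> real^2 \<Rightarrow> real^2) \<Rightarrow> real^2 \<Rightarrow> real^2 \<Rightarrow> real^2" where
  "pullback f \<phi> X Y = inv f (\<phi> (f X) (f Y))"

lemma contraction_pullback:
  assumes "contraction_by \<phi> f \<phi>'"
  shows "0 < t \<Longrightarrow> isomorphic_laws \<phi> (pullback (f t) \<phi>)"
    and "((\<lambda>t. pullback (f t) \<phi> X Y) \<longlongrightarrow> \<phi>' X Y) (at_right 0)"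
    and "\<forall>\<^sub>F t in at_right 0. commutative_law (pullback (f t) \<phi>)"
proof -
  show iso: "isomorphic_laws \<phi> (pullback (f t) \<phi>)" if "0 < t" for t
    using assms that unfolding contraction_by_def isomorphic_laws_def pullback_def by blast
  show "((\<lambda>t. pullback (f t) \<phi> X Y) \<longlongrightarrow> \<phi>' X Y) (at_right 0)"
    using assms unfolding contraction_by_def pullback_def by blast
  have "commutative_law \<phi>"
    using assms unfolding contraction_by_def jordan_laws_def by blast
  then show "\<forall>\<^sub>F t in at_right 0. commutative_law (pullback (f t) \<phi>)"
    using eventually_at_right_less[of "0::real"]
    by (auto elim!: eventually_mono intro: isomorphic_commutative_law[OF iso])
qed

text \<open>The inner product varies with \<open>t\<close>, which is why a moving argument is
  needed. Trace form and associativity are built from such iterated products.\<close>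

lemma contraction_iterated:
  assumes "contraction_by \<phi> f \<phi>'" "commutative_law \<phi>'"
  shows "((\<lambda>t. pullback (f t) \<phi> (pullback (f t) \<phi> X Y) Z) \<longlongrightarrow> \<phi>' (\<phi>' X Y) Z) (at_right 0)"
  by (rule tendsto_commutative_law[where \<Phi> = "\<lambda>t. pullback (f t) \<phi>" and \<phi> = \<phi>' and
        x = "\<lambda>t. pullback (f t) \<phi> X Y" and X = "\<phi>' X Y"])
    (rule contraction_pullback[OF assms(1)] assms(2))+

text \<open>The limit value lies in the open set \<open>S\<close>, so values for small
  \<open>t\<close> do as well, and these are values of an isomorphic copy of
  \<open>\<phi>\<close>.\<close>

lemma contraction_gram:
  assumes con: "contraction_by \<phi> f \<phi>'" and com: "commutative_law \<phi>'"
    and "open S" "gram \<phi>' X Y \<in> S"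
  shows "\<exists>X Y. gram \<phi> X Y \<in> S"
proof -
  have "((\<lambda>t. gram (pullback (f t) \<phi>) X Y) \<longlongrightarrow> gram \<phi>' X Y) (at_right 0)"
    unfolding gram_def trace_form_def tr2_def
    by (intro tendsto_intros contraction_iterated con com)
  from topological_tendstoD[OF this assms(3,4)]
  have "\<forall>\<^sub>F t in at_right 0. 0 < t \<and> gram (pullback (f t) \<phi>) X Y \<in> S"
    using eventually_at_right_less[of "0::real"] by (rule eventually_conj[rotated])
  then obtain t where t: "0 < t" "gram (pullback (f t) \<phi>) X Y \<in> S"
    using eventually_happens'[OF trivial_limit_at_right_real] by blast
  have "commutative_law \<phi>"
    using con by (auto simp: contraction_by_def jordan_laws_def)
  then show ?thesis
    using isomorphic_gram[OF contraction_pullback(1)[OF con t(1)], of "\<lambda>x. x \<in> S"] t(2) by blast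
qed

text \<open>Associativity is a closed condition: an identity valid for every \<open>t > 0\<close>
  survives in the limit.\<close>

lemma contraction_associative:
  assumes con: "contraction_by \<phi> f \<phi>'" and com: "commutative_law \<phi>'"
    and "associative_law \<phi>"
  shows "associative_law \<phi>'"
  unfolding associative_law_def
proof (intro allI)
  fix X Y Z
  let ?P = "\<lambda>t. pullback (f t) \<phi>"
  \<comment> \<open>Commutativity moves the inner product into the first argument on both sides, the
    form covered by \<open>contraction_iterated\<close>.\<close>
  have "\<forall>\<^sub>F t in at_right 0. ?P t (?P t X Y) Z = ?P t (?P t Y Z) X"
    using eventually_at_right_less[of "0::real"] contraction_pullback(3)[OF con]
  proof eventually_elim
    case (elim t)
    then show ?case
      using isomorphic_associative[OF contraction_pullback(1)[OF con elim(1)]] assms(3)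
        comm_commute[OF elim(2)]
      unfolding associative_law_def by metis
  qed
  with contraction_iterated[OF con com, of X Y Z]
  have "((\<lambda>t. ?P t (?P t Y Z) X) \<longlongrightarrow> \<phi>' (\<phi>' X Y) Z) (at_right 0)"
    by (rule Lim_transform_eventually)
  then have "\<phi>' (\<phi>' X Y) Z = \<phi>' (\<phi>' Y Z) X"
    using tendsto_unique[OF trivial_limit_at_right_real _ contraction_iterated[OF con com]] by blast
  then show "\<phi>' (\<phi>' X Y) Z = \<phi>' X (\<phi>' Y Z)"
    using comm_commute[OF com] by metis
qed

subsection \<open>Classification\<close>

lemma jordan_commutative: "\<phi> \<in> jordan_laws \<Longrightarrow> commutative_law \<phi>"
  by (simp add: jordan_laws_def)

lemma jordan_identity:
  "\<phi> \<in> jordan_laws \<Longrightarrow> \<phi> (\<phi> X X) (\<phi> X Y) = \<phi> X (\<phi> (\<phi> X X) Y)"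
  by (simp add: jordan_laws_def)

lemma obtain_table:
  assumes "commutative_law \<phi>" "area u v \<noteq> 0"
  obtains a b c d p q where "has_table \<phi> u v a b c d p q"
  using assms area_expand[OF assms(2)] unfolding has_table_def by metis

text \<open>The Jordan identity for \<open>u + t v\<close>, with \<open>u\<close> idempotent, is polynomial in \<open>t\<close>; a few values of \<open>t\<close>
  determine its coefficients.\<close>

lemma peirce:
  assumes "law 1 0 c d p q \<in> jordan_laws"
  shows "d = 0 \<or> d = 1/2 \<or> d = 1" and "d = 1 \<Longrightarrow> c = 0"
    and "c = 0 \<Longrightarrow> d = 0 \<Longrightarrow> p = 0" and "c = 0 \<Longrightarrow> d = 1/2 \<Longrightarrow> p = 0 \<and> q = 0"
proof -
  note J = jordan_identity[OF assms, unfolded real2_eq_iff, simplified]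
  note J0 = jordan_identity[OF assms, unfolded real2_eq_iff law_nth, THEN conjunct2]
  \<comment> \<open>The points \<open>X = e_1 + t e_2\<close> for \<open>t = 1, -1, 2\<close>,
    together with \<open>X = e_2\<close> for the leading coefficient, determine a cubic in
    \<open>t\<close>.\<close>
  note J1 = J[of "vector [1, 1]" "vector [1, 0]", simplified]
    J[of "vector [1, -1]" "vector [1, 0]", simplified]
    J[of "vector [1, 2]" "vector [1, 0]", simplified]
    J[of "vector [0, 1]" "vector [1, 0]", simplified]
  note J2 = J[of "vector [1, 1]" "vector [0, 1]", simplified]
    J[of "vector [1, -1]" "vector [0, 1]", simplified]
    J[of "vector [1, 2]" "vector [0, 1]", simplified]
    J[of "vector [0, 1]" "vector [0, 1]", simplified]
  \<comment> \<open>With \<open>L\<close> the multiplication by \<open>e_1\<close>, the coefficient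
    of \<open>t\<close> for \<open>Y = e_1\<close> is, up to sign, \<open>2 L^3 - 3 L^2 + L\<close>
    applied to \<open>e_2\<close>; this is its second coordinate.\<close>
  have "2 * (d * d * d) - 3 * (d * d) + d = 0"
    using J0[of "vector [1, 1]" "vector [1, 0]", unfolded vector_2]
      J0[of "vector [1, -1]" "vector [1, 0]", unfolded vector_2]
      J0[of "vector [1, 2]" "vector [1, 0]", unfolded vector_2]
      J0[of "vector [0, 1]" "vector [1, 0]", unfolded vector_2]
    by algebra
  then have "d * ((2 * d - 1) * (d - 1)) = 0"
    by (simp add: algebra_simps)
  then show "d = 0 \<or> d = 1/2 \<or> d = 1"
    by auto
  show "c = 0" if "d = 1"
    using J1 unfolding that by (simp add: algebra_simps)
  show "p = 0" if "c = 0" "d = 0"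
    using J2 unfolding that by (simp add: algebra_simps)
  show "p = 0 \<and> q = 0" if "c = 0" "d = 1/2"
  proof -
    have "q = 0"
      using J1 unfolding that by (simp add: algebra_simps)
    moreover from this have "p * p = 0"
      using J2 unfolding that by (simp add: algebra_simps)
    ultimately show ?thesis
      by simp
  qed
qed

text \<open>Multiplication by \<open>e\<close> is diagonalised. For eigenvalue \<open>d\<close>
  other than 1 a shift by a multiple of \<open>e\<close> removes \<open>c\<close>; for
  \<open>d = 1\<close> the Jordan identity already forces \<open>c = 0\<close>.\<close>

lemma idempotent_table:
  assumes J: "\<phi> \<in> jordan_laws" and e: "e \<noteq> 0" "\<phi> e e = e"
  obtains w d p q where "has_table \<phi> e w 1 0 0 d p q"
proof -
  note comm = jordan_commutative[OF J]
  \<comment> \<open>\<open>e\<close> turned by a right angle, so that \<open>area e w\<close> is the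
    squared length of \<open>e\<close>.\<close>
  define w where "w = (vector [- e$2, e$1] :: real^2)"
  have "area e w = e$1 * e$1 + e$2 * e$2"
    by (simp add: area_def w_def)
  then have w: "area e w \<noteq> 0"
    using e(1) by (simp add: real2_eq_iff add_nonneg_eq_0_iff)
  obtain a b c d p q where tab: "has_table \<phi> e w a b c d p q"
    using obtain_table[OF comm w] .
  then have tab': "has_table \<phi> e w 1 0 c d p q"
    using e(2) by (simp add: has_table_def)
  show ?thesis
  proof (cases "d = 1")
    case True
    then show ?thesis
      using that tab' peirce(2)[OF isomorphic_jordan[OF isomorphic_law[OF tab'] J]] by simp
  next
    case False
    \<comment> \<open>Solves \<open>c + k = d * k\<close>, which makes \<open>w + k e\<close> an
      eigenvector.\<close>
    define k where "k = c / (d - 1)"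
    have k: "c + k = d * k"
      using False by (simp add: k_def field_simps)
    have w': "area e (w + k *\<^sub>R e) \<noteq> 0"
      using w by simp
    have "\<phi> e (w + k *\<^sub>R e) = (c + k) *\<^sub>R e + d *\<^sub>R w"
      using tab' by (simp add: has_table_def comm_bilinear[OF comm] algebra_simps)
    also have "\<dots> = d *\<^sub>R (w + k *\<^sub>R e)"
      by (simp add: k algebra_simps)
    finally have ew: "\<phi> e (w + k *\<^sub>R e) = d *\<^sub>R (w + k *\<^sub>R e)" .
    obtain p' q' where "\<phi> (w + k *\<^sub>R e) (w + k *\<^sub>R e) = p' *\<^sub>R e + q' *\<^sub>R (w + k *\<^sub>R e)"
      using area_expand[OF w'] by metis
    then have "has_table \<phi> e (w + k *\<^sub>R e) 1 0 0 d p' q'"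
      using comm w' ew e(2) by (simp add: has_table_def)
    then show ?thesis
      by (rule that)
  qed
qed

text \<open>The listed laws are the tables of \<open>\<psi>\<^sub>0\<close>,
  \<open>\<psi>\<^sub>1\<close>, \<open>\<psi>\<^sub>2\<close>, \<open>\<psi>\<^sub>4\<close>,
  \<open>\<psi>\<^sub>5\<close>. Eigenvalue 0 splits the algebra as a direct sum, 1/2 gives
  \<open>\<psi>\<^sub>4\<close>, and 1 makes \<open>e\<close> a unit, leaving a quadratic extension
  sorted by the sign of its discriminant.\<close>

lemma idempotent_cases:
  assumes J: "\<phi> \<in> jordan_laws" and e: "e \<noteq> 0" "\<phi> e e = e"
  shows "\<exists>\<psi> \<in> {law 1 0 0 1 1 0, law 1 0 0 1 0 0, law 0 0 0 0 0 1,
    law 1 0 0 (1/2) 0 0, law 1 0 0 1 (-1) 0}. isomorphic_laws \<phi> \<psi>"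
proof -
  note comm = jordan_commutative[OF J]
  obtain w d p q where tab: "has_table \<phi> e w 1 0 0 d p q"
    using idempotent_table[OF J e] .
  note P = peirce[OF isomorphic_jordan[OF isomorphic_law[OF tab] J]]
  have ee: "\<phi> e e = e" and ew: "\<phi> e w = d *\<^sub>R w" "\<phi> w e = d *\<^sub>R w"
    and ww: "\<phi> w w = p *\<^sub>R e + q *\<^sub>R w" and nz: "area e w \<noteq> 0"
    using tab comm_commute[OF comm, of w e] by (auto simp: has_table_def)
  consider "d = 0" | "d = 1/2" | "d = 1"
    using P(1) by blast
  then show ?thesis
  proof cases
    case 1
    then have [simp]: "p = 0"
      using P(3) by simp
    show ?thesis
    proof (cases "q = 0")
      case True
      \<comment> \<open>The basis is swapped because \<open>\<psi>\<^sub>2\<close> has its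
        idempotent in second place.\<close>
      then have "has_table \<phi> w e 0 0 0 0 0 1"
        using 1 ee ew ww nz comm area_swap[of w e] by (simp add: has_table_def)
      then show ?thesis
        using isomorphic_law by blast
    next
      case False
      define f where "f = (1/q) *\<^sub>R w"
      have f: "\<phi> f f = f" "\<phi> e f = 0" "\<phi> f e = 0" "area e f \<noteq> 0"
        using 1 False ew ww nz by (simp_all add: f_def comm_bilinear[OF comm])
      \<comment> \<open>For orthogonal idempotents, \<open>e + f\<close> is the unit and
        \<open>e - f\<close> squares to it.\<close>
      have "has_table \<phi> (e + f) (e - f) 1 0 0 1 1 0"
        using f ee comm area_swap[of f e]
        by (simp add: has_table_def comm_bilinear[OF comm])
      then show ?thesis
        using isomorphic_law by blast
    qed
  next
    case 2
    then show ?thesis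
      using P(4)[OF refl 2] isomorphic_law[OF tab] by (metis insertCI)
  next
    case 3
    \<comment> \<open>Completing the square in \<open>w w = p e + q w\<close> gives
      \<open>w' w' = r e\<close>.\<close>
    define r where "r = p + q * q / 4"
    define w' where "w' = w - (q/2) *\<^sub>R e"
    have w': "\<phi> e w' = w'" "area e w' \<noteq> 0"
      using 3 ee ew nz by (simp_all add: w'_def comm_bilinear[OF comm])
    have "\<phi> w' w' = r *\<^sub>R e + (q *\<^sub>R w - (q/2) *\<^sub>R w - (q/2) *\<^sub>R w)"
      using 3 ee ew ww by (simp add: w'_def r_def comm_bilinear[OF comm] algebra_simps)
    also have "q *\<^sub>R w - (q/2) *\<^sub>R w - (q/2) *\<^sub>R w = 0"
      by (simp add: scaleR_left_diff_distrib[symmetric])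
    finally have w'w': "\<phi> w' w' = r *\<^sub>R e"
      by simp
    show ?thesis
    proof (cases "r = 0")
      case True
      then have "has_table \<phi> e w' 1 0 0 1 0 0"
        using w' w'w' ee comm by (simp add: has_table_def)
      then show ?thesis
        using isomorphic_law by blast
    next
      case False
      \<comment> \<open>Over the reals, rescaling normalises \<open>r\<close> to its sign only; this
        separates \<open>\<psi>\<^sub>0\<close> from \<open>\<psi>\<^sub>5\<close>.\<close>
      define z where "z = (1 / sqrt \<bar>r\<bar>) *\<^sub>R w'"
      have "\<phi> z z = (r / \<bar>r\<bar>) *\<^sub>R e"
        using w'w' by (simp add: z_def comm_bilinear[OF comm])
      then have "has_table \<phi> e z 1 0 0 1 (r / \<bar>r\<bar>) 0"
        using False w' ee comm by (simp add: has_table_def z_def comm_bilinear[OF comm])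
      moreover have "r / \<bar>r\<bar> = 1 \<or> r / \<bar>r\<bar> = -1"
        using False by (simp add: abs_if)
      ultimately show ?thesis
        using isomorphic_law by (metis insertCI)
    qed
  qed
qed

text \<open>If every square were parallel to its root, a nonzero square could be rescaled to an
  idempotent, so all squares and by polarisation all products would vanish. Hence some
  \<open>x\<close> and its square form a basis, and a nonzero cube of \<open>x\<close> would again
  produce an idempotent.\<close>

lemma no_idempotent_cases:
  assumes J: "\<phi> \<in> jordan_laws" and no: "\<And>e. \<phi> e e = e \<Longrightarrow> e = 0" and nz: "\<phi> \<noteq> (\<lambda>X Y. 0)"
  shows "isomorphic_laws \<phi> (law 0 1 0 0 0 0)"
proof -
  note comm = jordan_commutative[OF J]
  have "\<exists>x. area x (\<phi> x x) \<noteq> 0"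
  proof (rule ccontr)
    assume "\<not> ?thesis"
    then have par: "area x (\<phi> x x) = 0" for x
      by blast
    have sq: "\<phi> x x = 0" for x
    proof (cases "x = 0")
      case True
      then show ?thesis
        using comm_bilinear(3)[OF comm, of 0 0] by simp
    next
      case False
      then have n: "x$1 * x$1 + x$2 * x$2 \<noteq> 0"
        by (simp add: real2_eq_iff add_nonneg_eq_0_iff)
      \<comment> \<open>The coefficient of the orthogonal projection of the square onto
        \<open>x\<close>.\<close>
      define l where "l = (x$1 * \<phi> x x$1 + x$2 * \<phi> x x$2) / (x$1 * x$1 + x$2 * x$2)"
      have par': "x$1 * \<phi> x x$2 = x$2 * \<phi> x x$1"
        using par[of x] by (simp add: area_def)
      have "\<phi> x x $ 1 * (x$1 * x$1 + x$2 * x$2) = (x$1 * \<phi> x x$1 + x$2 * \<phi> x x$2) * x$1"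
        "\<phi> x x $ 2 * (x$1 * x$1 + x$2 * x$2) = (x$1 * \<phi> x x$1 + x$2 * \<phi> x x$2) * x$2"
        using par' by algebra+
      then have l: "\<phi> x x = l *\<^sub>R x"
        using n by (simp add: real2_eq_iff l_def field_simps)
      show ?thesis
      proof (cases "l = 0")
        case False
        then have "\<phi> ((1/l) *\<^sub>R x) ((1/l) *\<^sub>R x) = (1/l) *\<^sub>R x"
          by (simp add: comm_bilinear[OF comm] l)
        from no[OF this] \<open>x \<noteq> 0\<close> False show ?thesis
          by simp
      qed (simp add: l)
    qed
    have "\<phi> x y = 0" for x y
    proof -
      \<comment> \<open>Polarisation.\<close>
      have "2 *\<^sub>R \<phi> x y = \<phi> (x + y) (x + y) - \<phi> x x - \<phi> y y"
        using comm_commute[OF comm, of y x]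
        by (simp add: comm_bilinear[OF comm] scaleR_2)
      then show ?thesis
        by (simp add: sq)
    qed
    with nz show False
      by (simp add: fun_eq_iff)
  qed
  then obtain x where x: "area x (\<phi> x x) \<noteq> 0"
    by blast
  define y where "y = \<phi> x x"
  have nzy: "area x y \<noteq> 0"
    using x by (simp add: y_def)
  obtain \<alpha> \<beta> where xy: "\<phi> x y = \<alpha> *\<^sub>R x + \<beta> *\<^sub>R y"
    using area_expand[OF nzy] by metis
  have yx: "\<phi> y x = \<alpha> *\<^sub>R x + \<beta> *\<^sub>R y"
    using xy comm_commute[OF comm] by metis
  \<comment> \<open>At \<open>X = Y = x\<close> the Jordan identity reads
    \<open>y y = x (y x)\<close>, so \<open>xy\<close> determines \<open>yy\<close>.\<close>
  have yy: "\<phi> y y = (\<alpha> * \<beta>) *\<^sub>R x + (\<alpha> + \<beta> * \<beta>) *\<^sub>R y"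
    using jordan_identity[OF J, of x x]
    by (simp add: y_def[symmetric] yx comm_bilinear[OF comm] xy algebra_simps)
  have a0: "\<alpha> = 0"
  proof (rule ccontr)
    assume a: "\<alpha> \<noteq> 0"
    \<comment> \<open>Chosen so that its square is \<open>\<alpha>\<close> times itself; dividing by
      \<open>\<alpha>\<close> gives an idempotent.\<close>
    let ?z = "y - \<beta> *\<^sub>R x"
    have "\<phi> ?z ?z = \<alpha> *\<^sub>R ?z"
      by (simp add: comm_bilinear[OF comm] xy yx yy y_def[symmetric] algebra_simps)
    then have "\<phi> ((1/\<alpha>) *\<^sub>R ?z) ((1/\<alpha>) *\<^sub>R ?z) = (1/\<alpha>) *\<^sub>R ?z"
      using a by (simp add: comm_bilinear(3,4)[OF comm])
    from no[OF this] a have "?z = 0"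
      by simp
    then have "area x ?z = 0"
      by (simp only: area_def) simp
    then show False
      using nzy by simp
  qed
  have b0: "\<beta> = 0"
  proof (rule ccontr)
    assume b: "\<beta> \<noteq> 0"
    \<comment> \<open>Once \<open>\<alpha> = 0\<close>, the square of \<open>y\<close> is
      \<open>\<beta> * \<beta>\<close> times \<open>y\<close>.\<close>
    have "\<phi> ((1/(\<beta>*\<beta>)) *\<^sub>R y) ((1/(\<beta>*\<beta>)) *\<^sub>R y) = (1/(\<beta>*\<beta>)) *\<^sub>R y"
      using a0 b by (simp add: comm_bilinear[OF comm] yy)
    from no[OF this] b have "y = 0"
      by simp
    then show False
      using nzy by (simp add: area_def)
  qed
  have "has_table \<phi> x y 0 1 0 0 0 0"
    using comm nzy xy yy by (simp add: has_table_def a0 b0 y_def)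
  then show ?thesis
    by (rule isomorphic_law)
qed

lemma jordan_classification:
  assumes "\<phi> \<in> jordan_laws" "\<phi> \<noteq> (\<lambda>X Y. 0)"
  shows "\<exists>\<psi> \<in> {law 1 0 0 1 1 0, law 1 0 0 1 0 0, law 0 0 0 0 0 1, law 0 1 0 0 0 0,
    law 1 0 0 (1/2) 0 0, law 1 0 0 1 (-1) 0}. isomorphic_laws \<phi> \<psi>"
  using idempotent_cases[of \<phi>] no_idempotent_cases[of \<phi>] assms by blast

subsection \<open>Contractions\<close>

text \<open>The contracting family consists of the frames \<open>u t\<close>, \<open>v t\<close>. A
  law depends linearly on its six structure constants, so their convergence suffices.\<close>

lemma contractionI:
  assumes J: "\<phi> \<in> jordan_laws"
    and tab: "\<And>t::real. 0 < t \<Longrightarrow> has_table \<phi> (u t) (v t) (a t) (b t) (c t) (d t) (p t) (q t)"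
    and lim: "(a \<longlongrightarrow> a') (at_right 0)" "(b \<longlongrightarrow> b') (at_right 0)"
      "(c \<longlongrightarrow> c') (at_right 0)" "(d \<longlongrightarrow> d') (at_right 0)"
      "(p \<longlongrightarrow> p') (at_right 0)" "(q \<longlongrightarrow> q') (at_right 0)"
    and iso: "isomorphic_laws \<phi>' (law a' b' c' d' p' q')"
  shows "is_contraction_of \<phi>' \<phi>"
proof -
  have "contraction_by \<phi> (\<lambda>t. frame (u t) (v t)) (law a' b' c' d' p' q')"
    unfolding contraction_by_def
  proof (intro conjI allI impI J)
    fix t :: real assume "0 < t"
    then show "frame (u t) (v t) \<in> GL"
      using tab[of t] by (auto simp: has_table_def intro: frame_GL)
  next
    fix X Y
    have "((\<lambda>t. law (a t) (b t) (c t) (d t) (p t) (q t) X Y) \<longlongrightarrow> law a' b' c' d' p' q' X Y)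
        (at_right 0)"
    proof (rule vec_tendstoI)
      fix i :: 2
      consider "i = 1" | "i = 2"
        using exhaust_2 by blast
      then show "((\<lambda>t. law (a t) (b t) (c t) (d t) (p t) (q t) X Y $ i) \<longlongrightarrow>
          law a' b' c' d' p' q' X Y $ i) (at_right 0)"
        by cases (simp_all only: law_nth, (intro tendsto_intros lim)+)
    qed
    moreover have "\<forall>\<^sub>F t in at_right 0. law (a t) (b t) (c t) (d t) (p t) (q t) X Y =
        inv (frame (u t) (v t)) (\<phi> (frame (u t) (v t) X) (frame (u t) (v t) Y))"
      using eventually_at_right_less[of "0::real"] by eventually_elim (simp add: frame_law[OF tab])
    ultimately show "((\<lambda>t. inv (frame (u t) (v t)) (\<phi> (frame (u t) (v t) X) (frame (u t) (v t) Y)))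
        \<longlongrightarrow> law a' b' c' d' p' q' X Y) (at_right 0)"
      by (rule Lim_transform_eventually)
  qed
  then show ?thesis
    using iso unfolding is_contraction_of_def by blast
qed

text \<open>Give \<open>x\<close> weight 1 and its square weight 2: the product of \<open>x\<close>
  with itself respects the weights, while every other structure constant picks up a positive power
  of \<open>t\<close>.\<close>

lemma contraction_square:
  assumes J: "\<phi> \<in> jordan_laws" and x: "area x (\<phi> x x) \<noteq> 0"
    and iso: "isomorphic_laws \<phi>' (law 0 1 0 0 0 0)"
  shows "is_contraction_of \<phi>' \<phi>"
proof -
  note comm = jordan_commutative[OF J]
  define y where "y = \<phi> x x"
  have nzy: "area x y \<noteq> 0"
    using x by (simp add: y_def)
  obtain \<alpha> \<beta> where xy: "\<phi> x y = \<alpha> *\<^sub>R x + \<beta> *\<^sub>R y"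
    using area_expand[OF nzy] by metis
  obtain \<gamma> \<delta> where yy: "\<phi> y y = \<gamma> *\<^sub>R x + \<delta> *\<^sub>R y"
    using area_expand[OF nzy] by metis
  show ?thesis
  proof (rule contractionI[OF J])
    fix t :: real
    assume "0 < t"
    then show "has_table \<phi> (t *\<^sub>R x) (t\<^sup>2 *\<^sub>R y) 0 1 (\<alpha> * t\<^sup>2) (\<beta> * t) (\<gamma> * t ^ 3) (\<delta> * t\<^sup>2)"
      using nzy comm
      by (simp add: has_table_def comm_bilinear[OF comm] y_def[symmetric] xy yy algebra_simps
          power2_eq_square power3_eq_cube)
  qed (rule iso | rule tendsto_const | (rule tendsto_eq_intros refl | simp)+)+
qed

text \<open>Shrinking \<open>v\<close> next to the unit \<open>u\<close> multiplies \<open>p\<close>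
  by the square of \<open>t\<close> and leaves the other constants alone.\<close>

lemma contraction_scale:
  assumes J: "\<phi> \<in> jordan_laws" and tab: "has_table \<phi> u v 1 0 0 1 p 0"
    and iso: "isomorphic_laws \<phi>' (law 1 0 0 1 0 0)"
  shows "is_contraction_of \<phi>' \<phi>"
proof (rule contractionI[OF J])
  note comm = jordan_commutative[OF J]
  fix t :: real
  assume "0 < t"
  then show "has_table \<phi> u (t *\<^sub>R v) 1 0 0 1 (p * t\<^sup>2) 0"
    using tab comm by (simp add: has_table_def comm_bilinear[OF comm] power2_eq_square algebra_simps)
qed (rule iso | rule tendsto_const | (rule tendsto_eq_intros refl | simp)+)+

text \<open>Half of \<open>u + v\<close> and half of \<open>u - v\<close> are orthogonal
  idempotents. Shrinking the first makes its square vanish in the limit; the second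
  persists.\<close>

lemma contraction_idempotents:
  assumes J: "\<phi> \<in> jordan_laws" and tab: "has_table \<phi> u v 1 0 0 1 1 0"
    and iso: "isomorphic_laws \<phi>' (law 0 0 0 0 0 1)"
  shows "is_contraction_of \<phi>' \<phi>"
proof (rule contractionI[OF J])
  note comm = jordan_commutative[OF J]
  have vu: "\<phi> v u = \<phi> u v"
    by (rule comm_commute[OF comm])
  fix t :: real
  assume "0 < t"
  then show "has_table \<phi> ((t/2) *\<^sub>R (u + v)) ((1/2) *\<^sub>R (u - v)) t 0 0 0 0 1"
    using tab comm area_swap[of v u]
    by (simp add: has_table_def comm_bilinear[OF comm] vu algebra_simps)
      (simp add: real2_eq_iff)
qed (rule iso | rule tendsto_const | (rule tendsto_eq_intros refl | simp)+)+

section \<open>Invariants of the six normal forms and rigidity\<close>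

lemma jordan_law_laws:
  "law 1 0 0 1 1 0 \<in> jordan_laws" "law 1 0 0 1 0 0 \<in> jordan_laws"
  "law 0 0 0 0 0 1 \<in> jordan_laws" "law 0 1 0 0 0 0 \<in> jordan_laws"
  "law 1 0 0 (1/2) 0 0 \<in> jordan_laws" "law 1 0 0 1 (-1) 0 \<in> jordan_laws"
  by (simp_all add: jordan_laws_def commutative_law_law real2_eq_iff) (algebra | simp add: field_simps)+

text \<open>The factor before the squared area is the determinant of the trace form in the standard
  basis; it is zero where that form has rank at most one.\<close>

lemma gram_laws:
  "gram (law 1 0 0 1 1 0) X Y = 4 * (area X Y)\<^sup>2" "gram (law 1 0 0 1 0 0) X Y = 0"
  "gram (law 0 0 0 0 0 1) X Y = 0" "gram (law 0 1 0 0 0 0) X Y = 0"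
  "gram (law 1 0 0 (1/2) 0 0) X Y = 0" "gram (law 1 0 0 1 (-1) 0) X Y = - 4 * (area X Y)\<^sup>2"
  by (simp_all add: gram_def trace_form_law area_def power2_eq_square algebra_simps)

lemma associative_laws:
  "associative_law (law 1 0 0 1 1 0)" "associative_law (law 1 0 0 1 0 0)"
  "associative_law (law 0 0 0 0 0 1)" "associative_law (law 0 1 0 0 0 0)"
  "associative_law (law 1 0 0 1 (-1) 0)"
  by (simp_all add: associative_law_def real2_eq_iff algebra_simps)

text \<open>Bracketing \<open>e_1 e_1 e_2\<close> to the left gives half of \<open>e_2\<close>, to
  the right a quarter.\<close>

lemma not_associative_law: "\<not> associative_law (law 1 0 0 (1/2) 0 0)"
proof
  assume "associative_law (law 1 0 0 (1/2) 0 0)"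
  then have "law 1 0 0 (1/2) 0 0 (law 1 0 0 (1/2) 0 0 (vector [1,0]) (vector [1,0])) (vector [0,1]) $ 2
    = law 1 0 0 (1/2) 0 0 (vector [1,0]) (law 1 0 0 (1/2) 0 0 (vector [1,0]) (vector [0,1])) $ 2"
    unfolding associative_law_def by metis
  then show False
    by simp
qed

lemma area_axes: "area (vector [1,0]) (vector [0,1]) = 1"
  by (simp add: area_def)

lemma isomorphic_gram_iff:
  assumes "isomorphic_laws \<phi> \<phi>'" "commutative_law \<phi>"
  shows "(\<exists>X Y. P (gram \<phi> X Y)) \<longleftrightarrow> (\<exists>X Y. P (gram \<phi>' X Y))"
  using isomorphic_gram[OF assms] isomorphic_gram[OF isomorphic_laws_sym[OF assms(1)]]
    isomorphic_commutative_law[OF assms] by blast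

lemma gram_zero: "gram (\<lambda>X Y. 0) X Y = 0"
  by (simp add: gram_def trace_form_def tr2_def)

lemma gram_pos_imp_law:
  assumes J: "\<phi> \<in> jordan_laws" and pos: "0 < gram \<phi> X Y"
  shows "isomorphic_laws \<phi> (law 1 0 0 1 1 0)"
proof -
  have "\<phi> \<noteq> (\<lambda>X Y. 0)"
    using pos gram_zero by force
  from jordan_classification[OF J this] obtain \<psi> where
    "\<psi> \<in> {law 1 0 0 1 1 0, law 1 0 0 1 0 0, law 0 0 0 0 0 1, law 0 1 0 0 0 0,
      law 1 0 0 (1/2) 0 0, law 1 0 0 1 (-1) 0}" and iso: "isomorphic_laws \<phi> \<psi>"
    by blast
  moreover have "\<exists>X Y. 0 < gram \<psi> X Y"
    using isomorphic_gram_iff[OF iso jordan_commutative[OF J], of "\<lambda>x. 0 < x"] pos by blast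
  ultimately have "\<psi> = law 1 0 0 1 1 0"
    by (auto simp: gram_laws not_less)
  with iso show ?thesis
    by simp
qed

lemma gram_neg_imp_law:
  assumes J: "\<phi> \<in> jordan_laws" and neg: "gram \<phi> X Y < 0"
  shows "isomorphic_laws \<phi> (law 1 0 0 1 (-1) 0)"
proof -
  have "\<phi> \<noteq> (\<lambda>X Y. 0)"
    using neg gram_zero by force
  from jordan_classification[OF J this] obtain \<psi> where
    "\<psi> \<in> {law 1 0 0 1 1 0, law 1 0 0 1 0 0, law 0 0 0 0 0 1, law 0 1 0 0 0 0,
      law 1 0 0 (1/2) 0 0, law 1 0 0 1 (-1) 0}" and iso: "isomorphic_laws \<phi> \<psi>"
    by blast
  moreover have "\<exists>X Y. gram \<psi> X Y < 0"
    using isomorphic_gram_iff[OF iso jordan_commutative[OF J], of "\<lambda>x. x < 0"] neg by blast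
  ultimately have "\<psi> = law 1 0 0 1 (-1) 0"
    by (auto simp: gram_laws not_less)
  with iso show ?thesis
    by simp
qed

lemma not_associative_imp_law:
  assumes J: "\<phi> \<in> jordan_laws" and nonassoc: "\<not> associative_law \<phi>"
  shows "isomorphic_laws \<phi> (law 1 0 0 (1/2) 0 0)"
proof -
  have "\<phi> \<noteq> (\<lambda>X Y. 0)"
    using nonassoc by (auto simp: associative_law_def)
  from jordan_classification[OF J this] obtain \<psi> where
    "\<psi> \<in> {law 1 0 0 1 1 0, law 1 0 0 1 0 0, law 0 0 0 0 0 1, law 0 1 0 0 0 0,
      law 1 0 0 (1/2) 0 0, law 1 0 0 1 (-1) 0}" and iso: "isomorphic_laws \<phi> \<psi>"
    by blast
  moreover have "\<not> associative_law \<psi>"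
    using isomorphic_associative[OF iso] nonassoc by blast
  ultimately have "\<psi> = law 1 0 0 (1/2) 0 0"
    using associative_laws by auto
  with iso show ?thesis
    by simp
qed

text \<open>Each of the three laws is singled out among the normal forms by an open condition:
  positive Gram value, negative Gram value, or failure of associativity. The condition passes from
  the contraction back to \<open>\<phi>\<close>, which places \<open>\<phi>\<close> in the same
  class.\<close>

lemma rigid:
  assumes J': "\<phi>' \<in> jordan_laws" and J: "\<phi> \<in> jordan_laws" and con: "is_contraction_of \<phi>' \<phi>"
    and iso: "isomorphic_laws \<phi>' \<psi>"
    and \<psi>: "\<psi> \<in> {law 1 0 0 1 1 0, law 1 0 0 (1/2) 0 0, law 1 0 0 1 (-1) 0}"
  shows "isomorphic_laws \<phi>' \<phi>"
proof -
  obtain f \<phi>'' where f: "contraction_by \<phi> f \<phi>''" and iso'': "isomorphic_laws \<phi>' \<phi>''"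
    using con unfolding is_contraction_of_def by blast
  have c: "commutative_law \<phi>''"
    using isomorphic_commutative_law[OF iso'' jordan_commutative[OF J']] .
  have iso2: "isomorphic_laws \<phi>'' \<psi>"
    using isomorphic_laws_trans[OF isomorphic_laws_sym[OF iso''] iso] .
  have "isomorphic_laws \<phi> \<psi>"
    using \<psi>
  proof (elim insertE emptyE)
    assume eq: "\<psi> = law 1 0 0 1 1 0"
    have "gram \<psi> (vector [1,0]) (vector [0,1]) > 0"
      unfolding eq gram_laws area_axes by simp
    then obtain X Y where pos: "gram \<phi>'' X Y > 0"
      using isomorphic_gram_iff[OF iso2 c, of "\<lambda>x. 0 < x"] by blast
    then obtain X Y where "gram \<phi> X Y > 0"
      using contraction_gram[OF f c open_greaterThan, unfolded greaterThan_iff, OF pos] by blast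
    then show ?thesis
      using gram_pos_imp_law[OF J] eq by blast
  next
    assume eq: "\<psi> = law 1 0 0 1 (-1) 0"
    have "gram \<psi> (vector [1,0]) (vector [0,1]) < 0"
      unfolding eq gram_laws area_axes by simp
    then obtain X Y where neg: "gram \<phi>'' X Y < 0"
      using isomorphic_gram_iff[OF iso2 c, of "\<lambda>x. x < 0"] by blast
    then obtain X Y where "gram \<phi> X Y < 0"
      using contraction_gram[OF f c open_lessThan, unfolded lessThan_iff, OF neg] by blast
    then show ?thesis
      using gram_neg_imp_law[OF J] eq by blast
  next
    assume eq: "\<psi> = law 1 0 0 (1/2) 0 0"
    have "\<not> associative_law \<phi>"
      using contraction_associative[OF f c] isomorphic_associative[OF iso2] not_associative_law eq
      by blast
    then show ?thesis
      using not_associative_imp_law[OF J] eq by blast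
  qed
  then show ?thesis
    using isomorphic_laws_common[OF iso] by blast
qed

section \<open>Non-triviality of the contractions and assembly\<close>

lemma not_isomorphic_gram:
  assumes "isomorphic_laws \<phi> \<psi>" "isomorphic_laws \<phi>' \<psi>'" "commutative_law \<psi>"
    "\<And>X Y. gram \<psi> X Y = 0" "gram \<psi>' X Y \<noteq> 0"
  shows "\<not> isomorphic_laws \<phi> \<phi>'"
proof
  assume "isomorphic_laws \<phi> \<phi>'"
  then have "isomorphic_laws \<psi> \<psi>'"
    using assms(1,2) isomorphic_laws_sym isomorphic_laws_trans by blast
  from isomorphic_gram_iff[OF this assms(3), of "\<lambda>x. x \<noteq> 0"] assms(4,5) show False
    by blast
qed

text \<open>A finer test, needed to tell \<open>\<psi>\<^sub>3\<close> from
  \<open>\<psi>\<^sub>1\<close> and \<open>\<psi>\<^sub>2\<close>: the Gram determinant vanishes for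
  all three, the trace form only for \<open>\<psi>\<^sub>3\<close>.\<close>

lemma not_isomorphic_trace_form:
  assumes "isomorphic_laws \<phi> \<psi>" "isomorphic_laws \<phi>' \<psi>'" "commutative_law \<psi>"
    "\<And>X Y. trace_form \<psi> X Y = 0" "trace_form \<psi>' X Y \<noteq> 0"
  shows "\<not> isomorphic_laws \<phi> \<phi>'"
proof
  assume "isomorphic_laws \<phi> \<phi>'"
  then have "isomorphic_laws \<psi> \<psi>'"
    using assms(1,2) isomorphic_laws_sym isomorphic_laws_trans by blast
  from isomorphic_trace_form[OF this assms(3), of "\<lambda>x. x \<noteq> 0"] assms(4,5) show False
    by blast
qed

lemma nontrivial_contraction_transport:
  assumes "is_nontrivial_contraction_of \<psi> \<phi>" "isomorphic_laws \<phi>' \<psi>"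
  shows "is_nontrivial_contraction_of \<phi>' \<phi>"
  using assms isomorphic_laws_sym isomorphic_laws_trans
  unfolding is_nontrivial_contraction_of_def is_contraction_of_def by meson

theorem proposition7:
  fixes e\<^sub>1 e\<^sub>2 :: "real^2"
    and \<psi>\<^sub>0 \<psi>\<^sub>1 \<psi>\<^sub>2 \<psi>\<^sub>3 \<psi>\<^sub>4 \<psi>\<^sub>5 :: "real^2 \<Rightarrow> real^2 \<Rightarrow> real^2"
  assumes "independent {e\<^sub>1, e\<^sub>2}" and "span {e\<^sub>1, e\<^sub>2} = UNIV"
    and "commutative_law \<psi>\<^sub>0" "\<psi>\<^sub>0 e\<^sub>1 e\<^sub>1 = e\<^sub>1" "\<psi>\<^sub>0 e\<^sub>2 e\<^sub>2 = e\<^sub>1" "\<psi>\<^sub>0 e\<^sub>1 e\<^sub>2 = e\<^sub>2"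
    and "commutative_law \<psi>\<^sub>1" "\<psi>\<^sub>1 e\<^sub>1 e\<^sub>1 = e\<^sub>1" "\<psi>\<^sub>1 e\<^sub>2 e\<^sub>2 = 0" "\<psi>\<^sub>1 e\<^sub>1 e\<^sub>2 = e\<^sub>2"
    and "commutative_law \<psi>\<^sub>2" "\<psi>\<^sub>2 e\<^sub>1 e\<^sub>1 = 0" "\<psi>\<^sub>2 e\<^sub>2 e\<^sub>2 = e\<^sub>2" "\<psi>\<^sub>2 e\<^sub>1 e\<^sub>2 = 0"
    and "commutative_law \<psi>\<^sub>3" "\<psi>\<^sub>3 e\<^sub>1 e\<^sub>1 = e\<^sub>2" "\<psi>\<^sub>3 e\<^sub>2 e\<^sub>2 = 0" "\<psi>\<^sub>3 e\<^sub>1 e\<^sub>2 = 0"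
    and "commutative_law \<psi>\<^sub>4" "\<psi>\<^sub>4 e\<^sub>1 e\<^sub>1 = e\<^sub>1" "\<psi>\<^sub>4 e\<^sub>2 e\<^sub>2 = 0" "\<psi>\<^sub>4 e\<^sub>1 e\<^sub>2 = (1/2) *\<^sub>R e\<^sub>2"
    and "commutative_law \<psi>\<^sub>5" "\<psi>\<^sub>5 e\<^sub>1 e\<^sub>1 = e\<^sub>1" "\<psi>\<^sub>5 e\<^sub>2 e\<^sub>2 = - e\<^sub>1" "\<psi>\<^sub>5 e\<^sub>1 e\<^sub>2 = e\<^sub>2"
  shows "{\<psi>\<^sub>0, \<psi>\<^sub>1, \<psi>\<^sub>2, \<psi>\<^sub>3, \<psi>\<^sub>4, \<psi>\<^sub>5} \<subseteq> jordan_laws \<and>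
    (\<forall>\<phi>'\<in>jordan_laws. \<phi>' \<noteq> (\<lambda>X Y. 0) \<longrightarrow>
       ((\<exists>\<phi>\<in>jordan_laws. is_nontrivial_contraction_of \<phi>' \<phi>) \<longleftrightarrow>
        (isomorphic_laws \<phi>' \<psi>\<^sub>1 \<or> isomorphic_laws \<phi>' \<psi>\<^sub>2 \<or> isomorphic_laws \<phi>' \<psi>\<^sub>3))) \<and>
    (is_nontrivial_contraction_of \<psi>\<^sub>1 \<psi>\<^sub>0 \<and> is_nontrivial_contraction_of \<psi>\<^sub>1 \<psi>\<^sub>5) \<and>
    is_nontrivial_contraction_of \<psi>\<^sub>2 \<psi>\<^sub>0 \<and>
    (is_nontrivial_contraction_of \<psi>\<^sub>3 \<psi>\<^sub>0 \<and> is_nontrivial_contraction_of \<psi>\<^sub>3 \<psi>\<^sub>1 \<and>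
     is_nontrivial_contraction_of \<psi>\<^sub>3 \<psi>\<^sub>2 \<and> is_nontrivial_contraction_of \<psi>\<^sub>3 \<psi>\<^sub>5)"
proof -
  have nz: "area e\<^sub>1 e\<^sub>2 \<noteq> 0"
    using assms(2) by (rule area_nonzero_of_span)
  have T0: "has_table \<psi>\<^sub>0 e\<^sub>1 e\<^sub>2 1 0 0 1 1 0" and T1: "has_table \<psi>\<^sub>1 e\<^sub>1 e\<^sub>2 1 0 0 1 0 0"
    and T2: "has_table \<psi>\<^sub>2 e\<^sub>1 e\<^sub>2 0 0 0 0 0 1" and T3: "has_table \<psi>\<^sub>3 e\<^sub>1 e\<^sub>2 0 1 0 0 0 0"
    and T4: "has_table \<psi>\<^sub>4 e\<^sub>1 e\<^sub>2 1 0 0 (1/2) 0 0" and T5: "has_table \<psi>\<^sub>5 e\<^sub>1 e\<^sub>2 1 0 0 1 (-1) 0"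
    using assms nz by (simp_all add: has_table_def)
  note I0 = isomorphic_law[OF T0] and I1 = isomorphic_law[OF T1] and I2 = isomorphic_law[OF T2]
    and I3 = isomorphic_law[OF T3] and I4 = isomorphic_law[OF T4] and I5 = isomorphic_law[OF T5]
  have J0: "\<psi>\<^sub>0 \<in> jordan_laws" and J1: "\<psi>\<^sub>1 \<in> jordan_laws" and J2: "\<psi>\<^sub>2 \<in> jordan_laws"
    and J3: "\<psi>\<^sub>3 \<in> jordan_laws" and J4: "\<psi>\<^sub>4 \<in> jordan_laws" and J5: "\<psi>\<^sub>5 \<in> jordan_laws"
    using isomorphic_jordan[OF isomorphic_laws_sym] I0 I1 I2 I3 I4 I5 jordan_law_laws by blast+
  have g0: "gram (law 1 0 0 1 1 0) (vector [1,0]) (vector [0,1]) \<noteq> 0"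
    and g5: "gram (law 1 0 0 1 (-1) 0) (vector [1,0]) (vector [0,1]) \<noteq> 0"
    by (simp_all only: gram_laws area_axes) simp_all
  note ng = not_isomorphic_gram[OF _ _ commutative_law_law]
    and nt = not_isomorphic_trace_form[OF _ _ commutative_law_law]
  have t3: "trace_form (law 0 1 0 0 0 0) X Y = 0" for X Y
    by (simp add: trace_form_law)
  have t1: "trace_form (law 1 0 0 1 0 0) (vector [1,0]) (vector [1,0]) \<noteq> 0"
    and t2: "trace_form (law 0 0 0 0 0 1) (vector [0,1]) (vector [0,1]) \<noteq> 0"
    by (simp_all add: trace_form_law)
  have c10: "is_nontrivial_contraction_of \<psi>\<^sub>1 \<psi>\<^sub>0"
    using contraction_scale[OF J0 T0 I1] ng[OF I1 I0 gram_laws(2) g0]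
    by (simp add: is_nontrivial_contraction_of_def)
  have c15: "is_nontrivial_contraction_of \<psi>\<^sub>1 \<psi>\<^sub>5"
    using contraction_scale[OF J5 T5 I1] ng[OF I1 I5 gram_laws(2) g5]
    by (simp add: is_nontrivial_contraction_of_def)
  have c20: "is_nontrivial_contraction_of \<psi>\<^sub>2 \<psi>\<^sub>0"
    using contraction_idempotents[OF J0 T0 I2] ng[OF I2 I0 gram_laws(3) g0]
    by (simp add: is_nontrivial_contraction_of_def)
  \<comment> \<open>Since \<open>e_1\<close> is idempotent, \<open>e_2\<close> serves as the vector
    independent of its square.\<close>
  have "area e\<^sub>2 (\<psi>\<^sub>0 e\<^sub>2 e\<^sub>2) \<noteq> 0" and "area e\<^sub>2 (\<psi>\<^sub>5 e\<^sub>2 e\<^sub>2) \<noteq> 0"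
    using T0 T5 area_swap[of e\<^sub>2 e\<^sub>1] by (simp_all add: has_table_def)
  then have c30: "is_nontrivial_contraction_of \<psi>\<^sub>3 \<psi>\<^sub>0" and c35: "is_nontrivial_contraction_of \<psi>\<^sub>3 \<psi>\<^sub>5"
    using contraction_square[OF J0 _ I3] ng[OF I3 I0 gram_laws(4) g0]
      contraction_square[OF J5 _ I3] ng[OF I3 I5 gram_laws(4) g5]
    by (simp_all add: is_nontrivial_contraction_of_def)
  \<comment> \<open>In \<open>\<psi>\<^sub>1\<close> and \<open>\<psi>\<^sub>2\<close> each basis
    vector is parallel to its square, so the sum of the two is used.\<close>
  have "\<psi>\<^sub>1 (e\<^sub>1 + e\<^sub>2) (e\<^sub>1 + e\<^sub>2) = e\<^sub>1 + 2 *\<^sub>R e\<^sub>2"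
    using T1 comm_commute[OF jordan_commutative[OF J1], of e\<^sub>2 e\<^sub>1]
    by (simp add: has_table_def comm_bilinear[OF jordan_commutative[OF J1]] scaleR_2)
  then have "area (e\<^sub>1 + e\<^sub>2) (\<psi>\<^sub>1 (e\<^sub>1 + e\<^sub>2) (e\<^sub>1 + e\<^sub>2)) \<noteq> 0"
    using nz area_swap[of e\<^sub>2 e\<^sub>1] by simp
  then have c31: "is_nontrivial_contraction_of \<psi>\<^sub>3 \<psi>\<^sub>1"
    using contraction_square[OF J1 _ I3] nt[OF I3 I1 t3 t1]
    unfolding is_nontrivial_contraction_of_def by blast
  have "area (e\<^sub>1 + e\<^sub>2) (\<psi>\<^sub>2 (e\<^sub>1 + e\<^sub>2) (e\<^sub>1 + e\<^sub>2)) \<noteq> 0"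
    using T2 comm_commute[OF jordan_commutative[OF J2], of e\<^sub>2 e\<^sub>1] area_swap[of e\<^sub>2 e\<^sub>1]
    by (simp add: has_table_def comm_bilinear[OF jordan_commutative[OF J2]])
  then have c32: "is_nontrivial_contraction_of \<psi>\<^sub>3 \<psi>\<^sub>2"
    using contraction_square[OF J2 _ I3] nt[OF I3 I2 t3 t2]
    unfolding is_nontrivial_contraction_of_def by blast
  have "(\<exists>\<phi>\<in>jordan_laws. is_nontrivial_contraction_of \<phi>' \<phi>) \<longleftrightarrow>
      (isomorphic_laws \<phi>' \<psi>\<^sub>1 \<or> isomorphic_laws \<phi>' \<psi>\<^sub>2 \<or> isomorphic_laws \<phi>' \<psi>\<^sub>3)"
    if J': "\<phi>' \<in> jordan_laws" and nz': "\<phi>' \<noteq> (\<lambda>X Y. 0)" for \<phi>'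
  proof
    assume "\<exists>\<phi>\<in>jordan_laws. is_nontrivial_contraction_of \<phi>' \<phi>"
    then obtain \<phi> where J: "\<phi> \<in> jordan_laws" and con: "is_contraction_of \<phi>' \<phi>"
      and ni: "\<not> isomorphic_laws \<phi>' \<phi>"
      by (auto simp: is_nontrivial_contraction_of_def)
    obtain \<psi> where \<psi>: "\<psi> \<in> {law 1 0 0 1 1 0, law 1 0 0 1 0 0, law 0 0 0 0 0 1, law 0 1 0 0 0 0,
        law 1 0 0 (1/2) 0 0, law 1 0 0 1 (-1) 0}" and iso: "isomorphic_laws \<phi>' \<psi>"
      using jordan_classification[OF J' nz'] by blast
    have "\<psi> \<notin> {law 1 0 0 1 1 0, law 1 0 0 (1/2) 0 0, law 1 0 0 1 (-1) 0}"
      using rigid[OF J' J con iso] ni by blast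
    with \<psi> have "\<psi> = law 1 0 0 1 0 0 \<or> \<psi> = law 0 0 0 0 0 1 \<or> \<psi> = law 0 1 0 0 0 0"
      by blast
    then show "isomorphic_laws \<phi>' \<psi>\<^sub>1 \<or> isomorphic_laws \<phi>' \<psi>\<^sub>2 \<or> isomorphic_laws \<phi>' \<psi>\<^sub>3"
      using isomorphic_laws_common[OF iso] I1 I2 I3 by blast
  next
    assume "isomorphic_laws \<phi>' \<psi>\<^sub>1 \<or> isomorphic_laws \<phi>' \<psi>\<^sub>2 \<or> isomorphic_laws \<phi>' \<psi>\<^sub>3"
    \<comment> \<open>One source is enough: \<open>\<psi>\<^sub>0\<close> contracts onto all three
      algebras.\<close>
    then show "\<exists>\<phi>\<in>jordan_laws. is_nontrivial_contraction_of \<phi>' \<phi>"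
      using nontrivial_contraction_transport c10 c20 c30 J0 by blast
  qed
  then show ?thesis
    using J0 J1 J2 J3 J4 J5 c10 c15 c20 c30 c31 c32 c35 by blast
qed

end
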